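(* Let $A$ be a commutative ring with unity, let $D\subseteq A[z]$ be Diophantine over $A[z]$, and let $\alpha\ge 0$ be an integer. Then $D_\alpha=\{f\in D:\deg(f)\le\alpha\}$, regarded as a subset of $A^{\alpha+1}$, is a countable union of subsets of $A^{\alpha+1}$ that are Diophantine over $A$.
   Context: For a ring $R$, a set $X\subseteq R^n$ is Diophantine over $R$ if there are polynomials $F_1,\dots,F_r\in R[x_1,\dots,x_n,y_1,\dots,y_m]$ such that $X=\{\mathbf a\in R^n:\exists \mathbf b\in R^m,\ F_j(\mathbf a,\mathbf b)=0 \text{ for all } j\}$. For $X\subseteq A[z]$ and $\alpha\ge0$, $X_\alpha=\{f\in X:\deg f\le\alpha\}$; the set $A[z]_\alpha$ of polynomials of degree at most $\alpha$ is identified with $A^{\alpha+1}$ via coefficients, which allows one to speak of Diophantine subsets of $A[z]_\alpha$ over $A$. *)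

theory Defs
  imports "HOL-Algebra.Indexed_Polynomials" "HOL-Algebra.UnivPoly" "HOL-Library.Countable_Set"
begin

context ring
begin

definition tuples :: "nat \<Rightarrow> 'a list set"
  where "tuples n = {xs. length xs = n \<and> set xs \<subseteq> carrier R}"

text \<open>The indexed polynomial \<open>P\<close> stores the coefficient of each monomial, a monomial being the
  multiset of its variables.  For \<open>P\<close> in \<^term>\<open>(carrier R)[\<X>\<^bsub>{..<k}\<^esub>]\<close> only finitely many
  coefficients are nonzero (lemma \<open>finite_support\<close> below), and \<open>P\<close> is evaluated by
  substituting \<open>xs ! i\<close> for the variable \<open>i\<close>.\<close>

definition indexed_poly_eval :: "(nat multiset \<Rightarrow> 'a) \<Rightarrow> 'a list \<Rightarrow> 'a"
  where "indexed_poly_eval P xs =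
    (\<Oplus>m \<in> {m. P m \<noteq> \<zero>}. P m \<otimes> (\<Otimes>i \<in> set_mset m. (xs ! i) [^] count m i))"

lemma finite_support:
  assumes "P \<in> ((carrier R)[\<X>\<^bsub>I\<^esub>])"
  shows "finite {m. P m \<noteq> \<zero>}"
  using assms
proof induction
  case (indexed_const k)
  show ?case
    by (rule finite_subset[of _ "{{#}}"]) (auto simp: indexed_const_def)
next
  case (indexed_padd P Q)
  then show ?case
    by (auto simp: indexed_padd_def
        intro: rev_finite_subset[of "{m. P m \<noteq> \<zero>} \<union> {m. Q m \<noteq> \<zero>}"])
next
  case (indexed_pmult P i)
  have "m \<in> add_mset i ` {m. P m \<noteq> \<zero>}" if "(P \<Otimes> i) m \<noteq> \<zero>" for m
  proof (rule image_eqI)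
    show "m = add_mset i (m - {#i#})" and "m - {#i#} \<in> {m. P m \<noteq> \<zero>}"
      using that by (simp_all add: indexed_pmult_def split: if_splits)
  qed
  then have "{m. (P \<Otimes> i) m \<noteq> \<zero>} \<subseteq> add_mset i ` {m. P m \<noteq> \<zero>}"
    by blast
  then show ?case
    using indexed_pmult by (meson finite_imageI finite_subset)
qed

text \<open>The variables \<open>0, \<dots>, n - 1\<close> are the parameters and \<open>n, \<dots>, n + m - 1\<close> are the
  existentially quantified unknowns.\<close>

definition diophantine :: "nat \<Rightarrow> 'a list set \<Rightarrow> bool"
  where "diophantine n S \<longleftrightarrow>
    (\<exists>m Fs. finite Fs \<and> Fs \<subseteq> ((carrier R)[\<X>\<^bsub>{..<n + m}\<^esub>]) \<and>
      S = {as \<in> tuples n. \<exists>bs \<in> tuples m. \<forall>F \<in> Fs. indexed_poly_eval F (as @ bs) = \<zero>})"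

end

text \<open>A polynomial of degree at most \<open>\<alpha>\<close> as the tuple of its coefficients, constant term
  first.  Note that \<^term>\<open>deg R\<close> of the zero polynomial is \<open>0\<close>, so that the zero polynomial has degree
  at most \<open>\<alpha>\<close> for every \<open>\<alpha>\<close>.\<close>

definition coeff_tuple :: "('a, 'm) ring_scheme \<Rightarrow> nat \<Rightarrow> (nat \<Rightarrow> 'a) \<Rightarrow> 'a list"
  where "coeff_tuple R \<alpha> f = map (coeff (UP R) f) [0..<\<alpha> + 1]"

definition degree_part :: "('a, 'm) ring_scheme \<Rightarrow> (nat \<Rightarrow> 'a) set \<Rightarrow> nat \<Rightarrow> (nat \<Rightarrow> 'a) set"
  where "degree_part R D \<alpha> = {f \<in> D. deg R f \<le> \<alpha>}"

end

theory Submission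
  imports Defs
begin

text \<open>Split \<open>D\<close> according to a bound \<open>\<beta>\<close> on the degrees of the unknowns.  For fixed \<open>\<beta>\<close> an unknown
  is given by \<open>\<beta> + 1\<close> elements of the base ring, and the degrees of the polynomials
  \<open>F(f, g\<^sub>1, \<dots>, g\<^sub>m)\<close> are bounded as well.  Hence finitely many coefficient equations, polynomial in
  the coefficients of \<open>f\<close> and of the \<open>g\<^sub>j\<close>, express their vanishing.\<close>

context cring
begin

section \<open>Evaluation of indexed polynomials as a homomorphism\<close>

definition multiset_eval :: "'a list \<Rightarrow> nat multiset \<Rightarrow> 'a"
  where "multiset_eval xs m = (\<Otimes>i \<in> set_mset m. (xs ! i) [^] count m i)"

lemma tuples_nth_closed: "\<lbrakk>xs \<in> tuples k; i < k\<rbrakk> \<Longrightarrow> xs ! i \<in> carrier R"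
  by (auto simp: tuples_def)

text \<open>The variables missing from \<open>m\<close> contribute \<open>x [^] 0\<close>, which is
  one. The index set thereby no longer depends on the monomial, and monomials can be compared factor
  by factor.\<close>

lemma multiset_eval_lessThan:
  assumes "xs \<in> tuples k" and "set_mset m \<subseteq> {..<k}"
  shows "multiset_eval xs m = (\<Otimes>i \<in> {..<k}. (xs ! i) [^] count m i)"
  unfolding multiset_eval_def
  by (rule finprod_mono_neutral_cong_left)
    (use assms in \<open>auto simp: not_in_iff tuples_nth_closed\<close>)

lemma multiset_eval_closed:
  assumes "xs \<in> tuples k" and "set_mset m \<subseteq> {..<k}"
  shows "multiset_eval xs m \<in> carrier R"
  unfolding multiset_eval_lessThan[OF assms]
  by (rule finprod_closed) (use assms in \<open>auto simp: tuples_nth_closed\<close>)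

lemma multiset_eval_add_mset:
  assumes "xs \<in> tuples k" and "set_mset m \<subseteq> {..<k}" and "i < k"
  shows "multiset_eval xs (add_mset i m) = multiset_eval xs m \<otimes> xs ! i"
proof -
  note closed = tuples_nth_closed[OF assms(1)]
  have "multiset_eval xs (add_mset i m) = (\<Otimes>j \<in> {..<k}. (xs ! j) [^] count (add_mset i m) j)"
    using assms by (intro multiset_eval_lessThan) auto
  \<comment> \<open>Only the exponent of \<open>i\<close> grows, by one. The extra factor is split
    off as a product whose factors are one away from \<open>i\<close>.\<close>
  also have "\<dots> = (\<Otimes>j \<in> {..<k}. (xs ! j) [^] count m j \<otimes> (if j = i then xs ! j else \<one>))"
    by (rule finprod_cong') (auto simp: closed)
  also have "\<dots> = (\<Otimes>j \<in> {..<k}. (xs ! j) [^] count m j) \<otimes> (\<Otimes>j \<in> {..<k}. if j = i then xs ! j else \<one>)"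
    by (rule finprod_multf) (auto simp: closed)
  also have "(\<Otimes>j \<in> {..<k}. if j = i then xs ! j else \<one>) = xs ! i"
    by (rule finprod_singleton_swap) (use assms in \<open>auto simp: closed\<close>)
  finally show ?thesis
    by (simp add: multiset_eval_lessThan[OF assms(1,2)])
qed

lemma indexed_pset_closed: "P \<in> indexed_pset I (carrier R) \<Longrightarrow> P m \<in> carrier R"
  using indexed_pset_in_carrier[of "carrier R" P I] by (simp add: carrier_coeff_def)

text \<open>Monomials are arbitrary multisets of naturals, while \<open>xs ! i\<close> is known to
  lie in the carrier only for \<open>i < k\<close>. This confines the monomials that matter to the
  admissible variables.\<close>

lemma indexed_pset_support:
  assumes "P \<in> indexed_pset I (carrier R)" and "P m \<noteq> \<zero>"
  shows "set_mset m \<subseteq> I"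
  using assms
proof (induction arbitrary: m)
  case (indexed_const k)
  then show ?case by (auto simp: indexed_const_def split: if_splits)
next
  case (indexed_padd P Q)
  then have "P m \<noteq> \<zero> \<or> Q m \<noteq> \<zero>" by (auto simp: indexed_padd_def)
  with indexed_padd.IH show ?case by blast
next
  case (indexed_pmult P i)
  then have "i \<in># m" and "P (m - {#i#}) \<noteq> \<zero>" by (auto simp: indexed_pmult_def split: if_splits)
  from indexed_pmult.IH[OF this(2)] indexed_pmult.hyps(2)
  have "insert i (set_mset (m - {#i#})) \<subseteq> I"
    by simp
  moreover have "add_mset i (m - {#i#}) = m"
    using \<open>i \<in># m\<close> by simp
  ultimately show ?case by (metis set_mset_add_mset_insert)
qed

text \<open>Cancellation can make the support of a sum smaller than the union of the supports.
  Summands with coefficient zero do no harm, so polynomials can be evaluated over one common finite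
  set \<open>S\<close>; the condition on the variables keeps every monomial value in the
  carrier.\<close>

lemma indexed_poly_eval_superset:
  assumes "P \<in> indexed_pset {..<k} (carrier R)" and "xs \<in> tuples k"
    and "finite S" and "{m. P m \<noteq> \<zero>} \<subseteq> S" and "\<And>m. m \<in> S \<Longrightarrow> set_mset m \<subseteq> {..<k}"
  shows "indexed_poly_eval P xs = (\<Oplus>m \<in> S. P m \<otimes> multiset_eval xs m)"
  unfolding indexed_poly_eval_def multiset_eval_def[symmetric]
  by (rule add.finprod_mono_neutral_cong_left)
    (use assms in \<open>auto simp: multiset_eval_closed indexed_pset_closed\<close>)

lemma indexed_poly_eval_support:
  assumes "P \<in> indexed_pset {..<k} (carrier R)" and "xs \<in> tuples k"
  shows "indexed_poly_eval P xs = (\<Oplus>m \<in> {m. P m \<noteq> \<zero>}. P m \<otimes> multiset_eval xs m)"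
  using assms indexed_pset_support[OF assms(1)]
  by (intro indexed_poly_eval_superset finite_support) auto

lemma indexed_poly_eval_closed:
  assumes "P \<in> indexed_pset {..<k} (carrier R)" and "xs \<in> tuples k"
  shows "indexed_poly_eval P xs \<in> carrier R"
  unfolding indexed_poly_eval_support[OF assms]
proof (intro add.finprod_closed Pi_I m_closed)
  fix m assume "m \<in> {m. P m \<noteq> \<zero>}"
  then show "P m \<in> carrier R" and "multiset_eval xs m \<in> carrier R"
    using assms indexed_pset_support[OF assms(1)]
    by (auto intro: indexed_pset_closed multiset_eval_closed)
qed

lemma indexed_poly_eval_const:
  assumes "c \<in> carrier R" and "xs \<in> tuples k"
  shows "indexed_poly_eval (indexed_const c) xs = c"
proof -
  have "indexed_poly_eval (indexed_const c) xs
      = (\<Oplus>m \<in> {{#}}. indexed_const c m \<otimes> multiset_eval xs m)"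
    using assms
    by (intro indexed_poly_eval_superset[of _ k] indexed_pset.indexed_const)
      (auto simp: indexed_const_def)
  also have "\<dots> = c"
    using assms by (simp add: multiset_eval_def indexed_const_def)
  finally show ?thesis .
qed

lemma indexed_poly_eval_padd:
  assumes "P \<in> indexed_pset {..<k} (carrier R)" and "Q \<in> indexed_pset {..<k} (carrier R)"
    and "xs \<in> tuples k"
  shows "indexed_poly_eval (indexed_padd P Q) xs = indexed_poly_eval P xs \<oplus> indexed_poly_eval Q xs"
proof -
  define S where "S = {m. P m \<noteq> \<zero>} \<union> {m. Q m \<noteq> \<zero>}"
  have fin: "finite S"
    unfolding S_def using assms by (simp add: finite_support)
  have vars: "set_mset m \<subseteq> {..<k}" if "m \<in> S" for m
    using that indexed_pset_support[OF assms(1)] indexed_pset_support[OF assms(2)]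
    unfolding S_def by blast
  have closed: "P m \<in> carrier R" "Q m \<in> carrier R" for m
    using assms indexed_pset_closed by blast+
  have mclosed: "multiset_eval xs m \<in> carrier R" if "m \<in> S" for m
    using that vars assms(3) multiset_eval_closed by blast
  have "indexed_poly_eval (indexed_padd P Q) xs
      = (\<Oplus>m \<in> S. indexed_padd P Q m \<otimes> multiset_eval xs m)"
    using assms fin vars
    by (intro indexed_poly_eval_superset[of _ k] indexed_pset.indexed_padd)
      (auto simp: S_def indexed_padd_def)
  also have "\<dots> = (\<Oplus>m \<in> S. P m \<otimes> multiset_eval xs m \<oplus> Q m \<otimes> multiset_eval xs m)"
    by (rule add.finprod_cong') (auto simp: indexed_padd_def l_distr closed mclosed)
  also have "\<dots> = (\<Oplus>m \<in> S. P m \<otimes> multiset_eval xs m) \<oplus> (\<Oplus>m \<in> S. Q m \<otimes> multiset_eval xs m)"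
    by (rule finsum_addf) (auto simp: closed mclosed)
  also have "(\<Oplus>m \<in> S. P m \<otimes> multiset_eval xs m) = indexed_poly_eval P xs"
    by (rule indexed_poly_eval_superset[symmetric]) (use assms fin vars in \<open>auto simp: S_def\<close>)
  also have "(\<Oplus>m \<in> S. Q m \<otimes> multiset_eval xs m) = indexed_poly_eval Q xs"
    by (rule indexed_poly_eval_superset[symmetric]) (use assms fin vars in \<open>auto simp: S_def\<close>)
  finally show ?thesis .
qed

lemma indexed_poly_eval_pmult:
  assumes P: "P \<in> indexed_pset {..<k} (carrier R)" and i: "i < k" and xs: "xs \<in> tuples k"
  shows "indexed_poly_eval (indexed_pmult P i) xs = indexed_poly_eval P xs \<otimes> xs ! i"
proof -
  define S where "S = {m. P m \<noteq> \<zero>}"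
  have fin: "finite S"
    unfolding S_def using P by (rule finite_support)
  have vars: "set_mset m \<subseteq> {..<k}" if "m \<in> S" for m
    using that indexed_pset_support[OF P] unfolding S_def by blast
  have closed: "P m \<in> carrier R" for m
    using P indexed_pset_closed by blast
  have mclosed: "multiset_eval xs m \<in> carrier R" if "m \<in> S" for m
    using that vars xs multiset_eval_closed by blast
  have iclosed: "xs ! i \<in> carrier R"
    using xs i by (rule tuples_nth_closed)
  have summand: "indexed_pmult P i (add_mset i m) \<otimes> multiset_eval xs (add_mset i m)
      = P m \<otimes> multiset_eval xs m \<otimes> xs ! i" if "m \<in> S" for m
    using multiset_eval_add_mset[OF xs vars[OF that] i]
    by (simp add: indexed_pmult_def m_assoc closed mclosed[OF that] iclosed)
  \<comment> \<open>The product with variable \<open>i\<close> has its support inside the shifted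
    support of \<open>P\<close>. The shift \<open>add_mset i\<close> is injective, so the sum over
    its image can be reindexed by \<open>S\<close>.\<close>
  have "m \<in> add_mset i ` S" if "indexed_pmult P i m \<noteq> \<zero>" for m
  proof (rule image_eqI)
    show "m = add_mset i (m - {#i#})" and "m - {#i#} \<in> S"
      using that by (simp_all add: S_def indexed_pmult_def split: if_splits)
  qed
  then have "indexed_poly_eval (indexed_pmult P i) xs
      = (\<Oplus>m \<in> add_mset i ` S. indexed_pmult P i m \<otimes> multiset_eval xs m)"
    using fin i
    by (intro indexed_poly_eval_superset[of _ k] indexed_pset.indexed_pmult P xs) (auto dest!: vars)
  also have "\<dots> = (\<Oplus>m \<in> S. indexed_pmult P i (add_mset i m) \<otimes> multiset_eval xs (add_mset i m))"
    by (rule finsum_reindex) (auto simp: summand closed mclosed iclosed inj_on_def)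
  also have "\<dots> = (\<Oplus>m \<in> S. P m \<otimes> multiset_eval xs m \<otimes> xs ! i)"
    by (rule add.finprod_cong') (auto simp: summand closed mclosed iclosed)
  also have "\<dots> = (\<Oplus>m \<in> S. P m \<otimes> multiset_eval xs m) \<otimes> xs ! i"
    by (rule finsum_ldistr[symmetric]) (auto simp: fin closed mclosed iclosed)
  finally show ?thesis
    unfolding S_def indexed_poly_eval_support[OF P xs] .
qed

section \<open>Polynomial functions on tuples and their closure properties\<close>

definition polynomial_function :: "nat \<Rightarrow> ('a list \<Rightarrow> 'a) \<Rightarrow> bool"
  where "polynomial_function k f \<longleftrightarrow>
    (\<exists>P \<in> indexed_pset {..<k} (carrier R). \<forall>xs \<in> tuples k. f xs = indexed_poly_eval P xs)"

lemma polynomial_function_closed: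
  "\<lbrakk>polynomial_function k f; xs \<in> tuples k\<rbrakk> \<Longrightarrow> f xs \<in> carrier R"
  unfolding polynomial_function_def using indexed_poly_eval_closed by auto

lemma polynomial_function_cong:
  assumes "polynomial_function k f" and "\<And>xs. xs \<in> tuples k \<Longrightarrow> g xs = f xs"
  shows "polynomial_function k g"
  using assms unfolding polynomial_function_def by auto

lemma polynomial_function_const: "c \<in> carrier R \<Longrightarrow> polynomial_function k (\<lambda>_. c)"
  unfolding polynomial_function_def
  by (rule bexI[of _ "indexed_const c"])
    (auto simp: indexed_poly_eval_const intro: indexed_pset.indexed_const)

lemma polynomial_function_add:
  assumes "polynomial_function k f" and "polynomial_function k g"
  shows "polynomial_function k (\<lambda>xs. f xs \<oplus> g xs)"
proof -
  obtain P Q where "P \<in> indexed_pset {..<k} (carrier R)" "\<forall>xs \<in> tuples k. f xs = indexed_poly_eval P xs"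
    and "Q \<in> indexed_pset {..<k} (carrier R)" "\<forall>xs \<in> tuples k. g xs = indexed_poly_eval Q xs"
    using assms unfolding polynomial_function_def by blast
  then show ?thesis
    unfolding polynomial_function_def
    by (intro bexI[of _ "indexed_padd P Q"])
      (auto simp: indexed_poly_eval_padd intro: indexed_pset.indexed_padd)
qed

lemma polynomial_function_mult_nth:
  assumes "polynomial_function k f" and "i < k"
  shows "polynomial_function k (\<lambda>xs. f xs \<otimes> xs ! i)"
proof -
  obtain P where "P \<in> indexed_pset {..<k} (carrier R)" "\<forall>xs \<in> tuples k. f xs = indexed_poly_eval P xs"
    using assms unfolding polynomial_function_def by blast
  then show ?thesis
    unfolding polynomial_function_def using assms(2)
    by (intro bexI[of _ "indexed_pmult P i"])
      (auto simp: indexed_poly_eval_pmult intro: indexed_pset.indexed_pmult)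
qed

lemma polynomial_function_nth:
  assumes "i < k"
  shows "polynomial_function k (\<lambda>xs. xs ! i)"
  by (rule polynomial_function_cong[OF
        polynomial_function_mult_nth[OF polynomial_function_const[OF one_closed] assms]])
    (simp add: tuples_nth_closed assms)

text \<open>Induction over \<open>indexed_pset\<close>, transferred from polynomials to the
  functions they induce. The case \<open>cong\<close> enters because the evaluation rules for
  constants, sums and products are equalities on \<open>tuples k\<close> only.\<close>

lemma polynomial_function_induct [consumes 1, case_names const sum mult_nth cong]:
  assumes "polynomial_function k f"
    and "\<And>c. c \<in> carrier R \<Longrightarrow> \<Phi> (\<lambda>_. c)"
    and "\<And>f g. \<lbrakk>polynomial_function k f; \<Phi> f; polynomial_function k g; \<Phi> g\<rbrakk> \<Longrightarrow> \<Phi> (\<lambda>xs. f xs \<oplus> g xs)"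
    and "\<And>f i. \<lbrakk>polynomial_function k f; \<Phi> f; i < k\<rbrakk> \<Longrightarrow> \<Phi> (\<lambda>xs. f xs \<otimes> xs ! i)"
    and cong: "\<And>f g. \<lbrakk>\<Phi> f; \<And>xs. xs \<in> tuples k \<Longrightarrow> g xs = f xs\<rbrakk> \<Longrightarrow> \<Phi> g"
  shows "\<Phi> f"
proof -
  have eval: "polynomial_function k (indexed_poly_eval P)"
    if "P \<in> indexed_pset {..<k} (carrier R)" for P
    using that unfolding polynomial_function_def by blast
  obtain P where "P \<in> indexed_pset {..<k} (carrier R)" and f: "\<forall>xs \<in> tuples k. f xs = indexed_poly_eval P xs"
    using assms(1) unfolding polynomial_function_def by blast
  from this(1) have "\<Phi> (indexed_poly_eval P)"
  proof induction
    case (indexed_const c)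
    show ?case
      by (rule cong[OF assms(2)]) (use indexed_const indexed_poly_eval_const in auto)
  next
    case (indexed_padd P Q)
    show ?case
      by (rule cong[OF assms(3)[OF eval _ eval]])
        (use indexed_padd indexed_poly_eval_padd in auto)
  next
    case (indexed_pmult P i)
    show ?case
      by (rule cong[OF assms(4)[OF eval]])
        (use indexed_pmult indexed_poly_eval_pmult in auto)
  qed
  with f show ?thesis
    using cong by blast
qed

text \<open>The set \<open>indexed_pset\<close> is generated by constants, sums and multiplication
  by one variable at a time; a general product is not a constructor. Induction on \<open>g\<close>
  reduces it to these by distributivity and associativity.\<close>

lemma polynomial_function_mult:
  assumes f: "polynomial_function k f" and g: "polynomial_function k g"
  shows "polynomial_function k (\<lambda>xs. f xs \<otimes> g xs)"
  using g
proof (induction rule: polynomial_function_induct)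
  case (const c)
  \<comment> \<open>Scaling by a constant is not a constructor either, so this case takes an inner
    induction on the other factor \<open>f\<close>.\<close>
  from f show ?case
  proof (induction rule: polynomial_function_induct)
    case (const d)
    with \<open>c \<in> carrier R\<close> show ?case
      by (intro polynomial_function_const) simp
  next
    case (sum f g)
    show ?case
      by (rule polynomial_function_cong[OF polynomial_function_add[OF sum.IH]])
        (use sum.hyps \<open>c \<in> carrier R\<close> in \<open>auto simp: l_distr polynomial_function_closed\<close>)
  next
    case (mult_nth f i)
    show ?case
      by (rule polynomial_function_cong[OF polynomial_function_mult_nth[OF mult_nth.IH]])
        (use mult_nth.hyps \<open>c \<in> carrier R\<close> in
          \<open>auto simp: m_ac polynomial_function_closed tuples_nth_closed\<close>)
  next
    case (cong f g)
    then show ?case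
      by (auto intro: polynomial_function_cong)
  qed
next
  case (sum g h)
  show ?case
    by (rule polynomial_function_cong[OF polynomial_function_add[OF sum.IH]])
      (use f sum.hyps in \<open>auto simp: r_distr polynomial_function_closed\<close>)
next
  case (mult_nth g i)
  show ?case
    by (rule polynomial_function_cong[OF polynomial_function_mult_nth[OF mult_nth.IH]])
      (use f mult_nth.hyps in \<open>auto simp: m_assoc polynomial_function_closed tuples_nth_closed\<close>)
next
  case (cong g h)
  then show ?case
    by (auto intro: polynomial_function_cong)
qed

lemma polynomial_function_finsum:
  assumes "finite S" and "\<And>i. i \<in> S \<Longrightarrow> polynomial_function k (f i)"
  shows "polynomial_function k (\<lambda>xs. \<Oplus>i \<in> S. f i xs)"
  using assms
proof (induction S)
  case empty
  show ?case
    by (simp add: polynomial_function_const)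
next
  case (insert i S)
  then have closed: "f j xs \<in> carrier R" if "j \<in> insert i S" "xs \<in> tuples k" for j xs
    using that polynomial_function_closed by blast
  show ?case
    by (rule polynomial_function_cong[OF polynomial_function_add[of k "f i"]])
      (use insert in \<open>auto intro!: finsum_insert simp: closed\<close>)
qed

section \<open>Diophantine sets cut out by polynomial functions\<close>

lemma tuples_append: "\<lbrakk>as \<in> tuples n; bs \<in> tuples m\<rbrakk> \<Longrightarrow> as @ bs \<in> tuples (n + m)"
  by (auto simp: tuples_def)

text \<open>Choosing one representing polynomial for each function suffices: \<open>as @ bs\<close>
  always lies in \<open>tuples (n + m)\<close>, where the function and its polynomial agree.
  Equations can then be handled through closure properties instead of explicit polynomials.\<close>

lemma diophantineI:
  assumes "finite \<Phi>" and "\<And>f. f \<in> \<Phi> \<Longrightarrow> polynomial_function (n + m) f"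
  shows "diophantine n {as \<in> tuples n. \<exists>bs \<in> tuples m. \<forall>f \<in> \<Phi>. f (as @ bs) = \<zero>}"
proof -
  have "\<forall>f \<in> \<Phi>. \<exists>P. P \<in> indexed_pset {..<n + m} (carrier R) \<and>
      (\<forall>xs \<in> tuples (n + m). f xs = indexed_poly_eval P xs)"
    using assms(2) unfolding polynomial_function_def by blast
  then obtain p where p: "\<And>f. f \<in> \<Phi> \<Longrightarrow> p f \<in> indexed_pset {..<n + m} (carrier R)"
    and "\<And>f xs. \<lbrakk>f \<in> \<Phi>; xs \<in> tuples (n + m)\<rbrakk> \<Longrightarrow> f xs = indexed_poly_eval (p f) xs"
    by metis
  then have "{as \<in> tuples n. \<exists>bs \<in> tuples m. \<forall>f \<in> \<Phi>. f (as @ bs) = \<zero>}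
      = {as \<in> tuples n. \<exists>bs \<in> tuples m. \<forall>F \<in> p ` \<Phi>. indexed_poly_eval F (as @ bs) = \<zero>}"
    using tuples_append by auto
  then show ?thesis
    unfolding diophantine_def using p \<open>finite \<Phi>\<close>
    by (intro exI[of _ m] exI[of _ "p ` \<Phi>"]) auto
qed

section \<open>Polynomials encoded as segments of a coefficient tuple\<close>

definition segment_poly :: "'a list \<Rightarrow> nat \<Rightarrow> nat \<Rightarrow> nat \<Rightarrow> 'a"
  where "segment_poly xs s w = (\<lambda>l. if l < w then xs ! (s + l) else \<zero>)"

text \<open>The first block of length \<open>a\<close> carries the parameter polynomial, and each of
  the \<open>m\<close> following blocks of length \<open>b\<close> carries one unknown. This matches
  a tuple \<open>as @ bs\<close> over the base ring with a tuple \<open>f # gs\<close> over the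
  polynomial ring.\<close>

definition unpack :: "nat \<Rightarrow> nat \<Rightarrow> nat \<Rightarrow> 'a list \<Rightarrow> (nat \<Rightarrow> 'a) list"
  where "unpack a b m xs =
    segment_poly xs 0 a # map (\<lambda>j. segment_poly xs (a + j * b) b) [0..<m]"

end

context UP_cring
begin

lemma segment_poly_closed:
  assumes "xs \<in> R.tuples k" and "s + w \<le> k"
  shows "R.segment_poly xs s w \<in> carrier P"
proof -
  have "R.segment_poly xs s w \<in> up R"
    using assms by (auto simp: R.segment_poly_def R.tuples_nth_closed intro!: exI[of _ w] bound.intro)
  then show ?thesis
    unfolding P_def UP_def by (simp only: partial_object.select_convs)
qed

lemma coeff_segment_poly:
  assumes "xs \<in> R.tuples k" and "s + w \<le> k"
  shows "up_ring.coeff P (R.segment_poly xs s w) l = (if l < w then xs ! (s + l) else \<zero>)"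
proof -
  have "R.segment_poly xs s w \<in> up R"
    using segment_poly_closed[OF assms] unfolding P_def UP_def by (simp only: partial_object.select_convs)
  \<comment> \<open>The operation \<open>coeff\<close> is a function restricted to
    \<open>up R\<close>, so it returns the underlying function only once membership is
    known.\<close>
  then have "up_ring.coeff P (R.segment_poly xs s w) = R.segment_poly xs s w"
    unfolding P_def UP_def by (simp only: up_ring.select_convs restrict_apply if_True)
  then show ?thesis
    by (simp only: R.segment_poly_def)
qed

section \<open>Coefficients and degrees of values of polynomials over the polynomial ring\<close>

lemma coeff_eval_polynomial_function:
  assumes "F \<in> P.indexed_pset {..<n} (carrier P)"
    and "\<And>xs. xs \<in> R.tuples k \<Longrightarrow> \<sigma> xs \<in> P.tuples n"
    and "\<And>i l. i < n \<Longrightarrow> R.polynomial_function k (\<lambda>xs. up_ring.coeff P (\<sigma> xs ! i) l)"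
  shows "R.polynomial_function k (\<lambda>xs. up_ring.coeff P (P.indexed_poly_eval F (\<sigma> xs)) l)"
  using assms(1)
proof (induction arbitrary: l)
  case (indexed_const c)
  show ?case
    by (rule R.polynomial_function_cong[OF R.polynomial_function_const[of "up_ring.coeff P c l"]])
      (simp_all add: indexed_const P.indexed_poly_eval_const[OF indexed_const assms(2)])
next
  case (indexed_padd F G)
  note closed = indexed_padd.hyps[THEN P.indexed_poly_eval_closed, OF assms(2)]
  show ?case
    by (rule R.polynomial_function_cong[OF R.polynomial_function_add[OF indexed_padd.IH(1,2)[of l]]])
      (simp add: P.indexed_poly_eval_padd[OF indexed_padd.hyps assms(2)] closed)
next
  case (indexed_pmult F i)
  then have i: "i < n" by simp
  note closed = P.indexed_poly_eval_closed[OF indexed_pmult.hyps(1) assms(2)]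
    P.tuples_nth_closed[OF assms(2) i]
  \<comment> \<open>Coefficient \<open>l\<close> of a product is a convolution. It involves every
    coefficient up to \<open>l\<close> of the first factor, hence the induction with
    \<open>l\<close> arbitrary.\<close>
  have "R.polynomial_function k (\<lambda>xs. \<Oplus>j \<in> {..l}.
      up_ring.coeff P (P.indexed_poly_eval F (\<sigma> xs)) j \<otimes> up_ring.coeff P (\<sigma> xs ! i) (l - j))"
    by (intro R.polynomial_function_finsum R.polynomial_function_mult indexed_pmult.IH assms(3) i) simp
  then show ?case
    by (rule R.polynomial_function_cong)
      (simp add: P.indexed_poly_eval_pmult[OF indexed_pmult.hyps(1) i assms(2)] closed)
qed

text \<open>The bound is uniform in \<open>gs\<close>: a sum takes the maximum of the two bounds,
  and multiplication by a variable adds \<open>d\<close>.\<close>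

lemma deg_eval_bound:
  assumes "F \<in> P.indexed_pset {..<n} (carrier P)"
  shows "\<exists>e. \<forall>gs \<in> P.tuples n. (\<forall>g \<in> set gs. deg R g \<le> d) \<longrightarrow> deg R (P.indexed_poly_eval F gs) \<le> e"
  using assms
proof induction
  case (indexed_const c)
  then show ?case
    by (intro exI[of _ "deg R c"]) (simp add: P.indexed_poly_eval_const)
next
  case (indexed_padd F G)
  then obtain e e' where
    e: "\<forall>gs \<in> P.tuples n. (\<forall>g \<in> set gs. deg R g \<le> d) \<longrightarrow> deg R (P.indexed_poly_eval F gs) \<le> e"
    "\<forall>gs \<in> P.tuples n. (\<forall>g \<in> set gs. deg R g \<le> d) \<longrightarrow> deg R (P.indexed_poly_eval G gs) \<le> e'"
    by blast
  have "deg R (P.indexed_poly_eval (P.indexed_padd F G) gs) \<le> max e e'"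
    if gs: "gs \<in> P.tuples n" "\<forall>g \<in> set gs. deg R g \<le> d" for gs
  proof -
    note closed = indexed_padd.hyps[THEN P.indexed_poly_eval_closed, OF gs(1)]
    have "deg R (P.indexed_poly_eval F gs) \<le> e" and "deg R (P.indexed_poly_eval G gs) \<le> e'"
      using e gs by blast+
    then show ?thesis
      unfolding P.indexed_poly_eval_padd[OF indexed_padd.hyps gs(1)]
      using deg_add[OF closed] by linarith
  qed
  then show ?case by blast
next
  case (indexed_pmult F i)
  then have i: "i < n" by simp
  obtain e where
    e: "\<forall>gs \<in> P.tuples n. (\<forall>g \<in> set gs. deg R g \<le> d) \<longrightarrow> deg R (P.indexed_poly_eval F gs) \<le> e"
    using indexed_pmult.IH by blast
  have "deg R (P.indexed_poly_eval (P.indexed_pmult F i) gs) \<le> e + d"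
    if gs: "gs \<in> P.tuples n" "\<forall>g \<in> set gs. deg R g \<le> d" for gs
  proof -
    have "gs ! i \<in> set gs"
      using gs(1) i unfolding P.tuples_def by simp
    then have "deg R (gs ! i) \<le> d"
      using gs(2) by blast
    moreover have "deg R (P.indexed_poly_eval F gs) \<le> e"
      using e gs by blast
    \<comment> \<open>The base ring may have zero divisors, so degrees need not add up; the
      inequality is enough for an upper bound.\<close>
    moreover have "deg R (P.indexed_poly_eval (P.indexed_pmult F i) gs)
        \<le> deg R (P.indexed_poly_eval F gs) + deg R (gs ! i)"
      unfolding P.indexed_poly_eval_pmult[OF indexed_pmult.hyps(1) i gs(1)]
      by (rule deg_mult_ring[OF P.indexed_poly_eval_closed[OF indexed_pmult.hyps(1) gs(1)]
            P.tuples_nth_closed[OF gs(1) i]])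
    ultimately show ?thesis by linarith
  qed
  then show ?case by blast
qed

text \<open>This trades one equation over the polynomial ring for finitely many over the base ring,
  as soon as a degree bound \<open>e\<close> is available.\<close>

lemma eq_zero_iff_coeff_atMost:
  assumes "p \<in> carrier P" and "deg R p \<le> e"
  shows "p = \<zero>\<^bsub>P\<^esub> \<longleftrightarrow> (\<forall>l \<le> e. up_ring.coeff P p l = \<zero>)"
proof
  assume *: "\<forall>l \<le> e. up_ring.coeff P p l = \<zero>"
  show "p = \<zero>\<^bsub>P\<^esub>"
  proof (rule up_eqI)
    show "up_ring.coeff P p l = up_ring.coeff P \<zero>\<^bsub>P\<^esub> l" for l
      using * assms deg_aboveD[of p l] by (cases "l \<le> e") auto
  qed (use assms in auto)
qed auto

section \<open>Unpacking tuples into polynomials and packing them back\<close>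

lemma unpack_closed:
  assumes "xs \<in> R.tuples (a + m * b)"
  shows "R.unpack a b m xs \<in> P.tuples (1 + m)"
proof -
  have "a + j * b + b \<le> a + m * b" if "j < m" for j
    using that mult_le_mono1[of "Suc j" m b] by simp
  then show ?thesis
    using segment_poly_closed[OF assms]
    by (auto simp: R.unpack_def P.tuples_def)
qed

lemma coeff_unpack:
  assumes "xs \<in> R.tuples (a + m * b)" and "i < 1 + m"
  shows "up_ring.coeff P (R.unpack a b m xs ! i) l =
    (case i of 0 \<Rightarrow> if l < a then xs ! l else \<zero> | Suc j \<Rightarrow> if l < b then xs ! (a + j * b + l) else \<zero>)"
proof (cases i)
  case 0
  then show ?thesis
    using coeff_segment_poly[OF assms(1), of 0 a] by (simp add: R.unpack_def)
next
  case (Suc j)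
  then have "a + j * b + b \<le> a + m * b"
    using assms(2) mult_le_mono1[of "Suc j" m b] by simp
  from coeff_segment_poly[OF assms(1) this] Suc assms(2) show ?thesis
    by (simp add: R.unpack_def del: upt_Suc)
qed

lemma coeff_unpack_polynomial_function:
  assumes "i < 1 + m"
  shows "R.polynomial_function (a + m * b) (\<lambda>xs. up_ring.coeff P (R.unpack a b m xs ! i) l)"
proof (rule R.polynomial_function_cong[OF _ coeff_unpack])
  \<comment> \<open>Each coefficient is a coordinate of \<open>xs\<close> or the constant zero; this
    inequality keeps the coordinate in range.\<close>
  have "a + j * b + l < a + m * b" if "j < m" "l < b" for j
    using that mult_le_mono1[of "Suc j" m b] by simp
  then show "R.polynomial_function (a + m * b) (\<lambda>xs. case i of
      0 \<Rightarrow> if l < a then xs ! l else \<zero> | Suc j \<Rightarrow> if l < b then xs ! (a + j * b + l) else \<zero>)"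
    using assms
    by (cases i; cases "l < a"; cases "l < b")
      (auto intro!: R.polynomial_function_const R.polynomial_function_nth)
qed (use assms in auto)

text \<open>The bound is deliberately rough: it covers empty blocks without subtraction, and all
  that matters later is that it does not depend on \<open>xs\<close>.\<close>

lemma deg_unpack:
  assumes "xs \<in> R.tuples (a + m * b)" and "g \<in> set (R.unpack a b m xs)"
  shows "deg R g \<le> max a b"
proof -
  note t = unpack_closed[OF assms(1)]
  obtain i where i: "i < 1 + m" "g = R.unpack a b m xs ! i"
    using assms(2) t by (auto simp: in_set_conv_nth P.tuples_def)
  show ?thesis
    unfolding i(2)
  proof (rule deg_aboveI)
    show "R.unpack a b m xs ! i \<in> carrier P"
      using P.tuples_nth_closed[OF t i(1)] .
  qed (simp add: coeff_unpack[OF assms(1) i(1)] split: nat.split)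
qed

text \<open>Polynomials of bounded degree, padded with zeros to full blocks, fit the encoding. This
  turns a solution over the polynomial ring into one over the base ring.\<close>

lemma unpack_surj:
  assumes f: "f \<in> carrier P" "deg R f \<le> \<alpha>"
    and gs: "gs \<in> P.tuples m" "\<And>g. g \<in> set gs \<Longrightarrow> deg R g \<le> \<beta>"
  obtains bs where "bs \<in> R.tuples (m * (\<beta> + 1))"
    and "R.unpack (\<alpha> + 1) (\<beta> + 1) m (coeff_tuple R \<alpha> f @ bs) = f # gs"
proof
  \<comment> \<open>Position \<open>k\<close> belongs to block \<open>k div (\<beta> + 1)\<close>
    and to coefficient \<open>k mod (\<beta> + 1)\<close> within that block.\<close>
  define bs where
    "bs = map (\<lambda>k. up_ring.coeff P (gs ! (k div (\<beta> + 1))) (k mod (\<beta> + 1))) [0..<m * (\<beta> + 1)]"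
  have gs_closed: "gs ! j \<in> carrier P" if "j < m" for j
    using gs(1) that by (rule P.tuples_nth_closed)
  show bs: "bs \<in> R.tuples (m * (\<beta> + 1))"
    using gs_closed by (auto simp: R.tuples_def bs_def less_mult_imp_div_less)
  have a: "coeff_tuple R \<alpha> f \<in> R.tuples (\<alpha> + 1)"
    using f by (auto simp: R.tuples_def coeff_tuple_def P_def[symmetric])
  note ab = R.tuples_append[OF a bs]
  note len_a = a[unfolded R.tuples_def, simplified, THEN conjunct1]
  note t = unpack_closed[OF ab]
  show "R.unpack (\<alpha> + 1) (\<beta> + 1) m (coeff_tuple R \<alpha> f @ bs) = f # gs"
  proof (rule nth_equalityI)
    show "length (R.unpack (\<alpha> + 1) (\<beta> + 1) m (coeff_tuple R \<alpha> f @ bs)) = length (f # gs)"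
      using gs(1) by (simp add: R.unpack_def P.tuples_def)
    fix i assume "i < length (R.unpack (\<alpha> + 1) (\<beta> + 1) m (coeff_tuple R \<alpha> f @ bs))"
    then have i: "i < 1 + m"
      by (simp add: R.unpack_def)
    show "R.unpack (\<alpha> + 1) (\<beta> + 1) m (coeff_tuple R \<alpha> f @ bs) ! i = (f # gs) ! i"
    proof (rule up_eqI)
      show "R.unpack (\<alpha> + 1) (\<beta> + 1) m (coeff_tuple R \<alpha> f @ bs) ! i \<in> carrier P"
        using P.tuples_nth_closed[OF t i] .
      show "(f # gs) ! i \<in> carrier P"
        using f(1) gs_closed i by (cases i) auto
      fix l
      show "up_ring.coeff P (R.unpack (\<alpha> + 1) (\<beta> + 1) m (coeff_tuple R \<alpha> f @ bs) ! i) l = up_ring.coeff P ((f # gs) ! i) l"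
      proof (cases i)
        \<comment> \<open>Beyond \<alpha> the segment is zero by default, and the coefficients of
          \<open>f\<close> vanish by the degree bound.\<close>
        case 0
        then show ?thesis
          using coeff_unpack[OF ab i, of l] f deg_aboveD[of f l] len_a
          by (auto simp: nth_append coeff_tuple_def P_def[symmetric] simp del: upt_Suc)
      next
        case (Suc j)
        have j: "j < m" using i Suc by simp
        then have deg: "deg R (gs ! j) \<le> \<beta>"
          using gs by (auto simp: P.tuples_def)
        show ?thesis
        proof (cases "l < \<beta> + 1")
          case True
          \<comment> \<open>Block \<open>j\<close> ends within the list, so the position is valid;
            since \<open>l < \<beta> + 1\<close>, division with remainder recovers \<open>j\<close>
            and \<open>l\<close>.\<close>
          have "Suc j * (\<beta> + 1) \<le> m * (\<beta> + 1)"
            using j by (intro mult_le_mono1) simp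
          with True have "j * (\<beta> + 1) + l < m * (\<beta> + 1)"
            by simp
          then have "bs ! (j * (\<beta> + 1) + l) = up_ring.coeff P (gs ! j) l"
            using True by (simp add: bs_def del: upt_Suc mult_Suc_right add_Suc_right)
          then show ?thesis
            using coeff_unpack[OF ab i, of l] Suc True len_a by (simp add: nth_append add.assoc)
        next
          case False
          then show ?thesis
            using coeff_unpack[OF ab i, of l] Suc deg gs_closed[OF j] deg_aboveD[of "gs ! j" l] by simp
        qed
      qed
    qed
  qed
qed

text \<open>The counterpart of \<open>unpack_surj\<close>: a solution over the base ring comes from
  a parameter polynomial of admissible degree whose coefficient tuple is the given one.\<close>

lemma coeff_tuple_hd_unpack:
  assumes "as \<in> R.tuples (\<alpha> + 1)" and "bs \<in> R.tuples (m * b)"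
  shows "coeff_tuple R \<alpha> (R.unpack (\<alpha> + 1) b m (as @ bs) ! 0) = as"
    and "deg R (R.unpack (\<alpha> + 1) b m (as @ bs) ! 0) \<le> \<alpha>"
proof -
  note ab = R.tuples_append[OF assms]
  note c = coeff_unpack[OF ab, of 0]
  have len: "length as = \<alpha> + 1"
    using assms(1) by (simp add: R.tuples_def)
  show "coeff_tuple R \<alpha> (R.unpack (\<alpha> + 1) b m (as @ bs) ! 0) = as"
    by (rule nth_equalityI)
      (use len c in \<open>auto simp: coeff_tuple_def P_def[symmetric] nth_append simp del: upt_Suc\<close>)
  show "deg R (R.unpack (\<alpha> + 1) b m (as @ bs) ! 0) \<le> \<alpha>"
  proof (rule deg_aboveI)
    show "R.unpack (\<alpha> + 1) b m (as @ bs) ! 0 \<in> carrier P"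
      by (rule P.tuples_nth_closed[OF unpack_closed[OF ab]]) simp
  qed (use c in simp)
qed

section \<open>The Diophantine pieces and their countable union\<close>

lemma diophantine_bounded_unknowns:
  assumes "finite Fs" and "Fs \<subseteq> P.indexed_pset {..<1 + m} (carrier P)"
  shows "R.diophantine (\<alpha> + 1) {as \<in> R.tuples (\<alpha> + 1). \<exists>bs \<in> R.tuples (m * b). \<forall>F \<in> Fs.
    P.indexed_poly_eval F (R.unpack (\<alpha> + 1) b m (as @ bs)) = \<zero>\<^bsub>P\<^esub>}"
proof -
  have "\<forall>F \<in> Fs. \<exists>e. \<forall>xs \<in> R.tuples (\<alpha> + 1 + m * b).
      deg R (P.indexed_poly_eval F (R.unpack (\<alpha> + 1) b m xs)) \<le> e"
  proof
    fix F assume "F \<in> Fs"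
    with assms(2) have "F \<in> P.indexed_pset {..<1 + m} (carrier P)" by blast
    \<comment> \<open>The value \<open>max (\<alpha> + 1) b\<close> is the bound of
      \<open>deg_unpack\<close> on all entries of an unpacked tuple.\<close>
    from deg_eval_bound[OF this, of "max (\<alpha> + 1) b"] obtain e where
      "\<forall>gs \<in> P.tuples (1 + m). (\<forall>g \<in> set gs. deg R g \<le> max (\<alpha> + 1) b) \<longrightarrow>
        deg R (P.indexed_poly_eval F gs) \<le> e" by blast
    then show "\<exists>e. \<forall>xs \<in> R.tuples (\<alpha> + 1 + m * b).
        deg R (P.indexed_poly_eval F (R.unpack (\<alpha> + 1) b m xs)) \<le> e"
      using unpack_closed deg_unpack by blast
  qed
  then obtain e where e: "\<And>F xs. \<lbrakk>F \<in> Fs; xs \<in> R.tuples (\<alpha> + 1 + m * b)\<rbrakk> \<Longrightarrow>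
      deg R (P.indexed_poly_eval F (R.unpack (\<alpha> + 1) b m xs)) \<le> e F"
    by metis
  \<comment> \<open>One function for each \<open>F\<close> and each \<open>l \<le> e F\<close>.
    Since \<open>e F\<close> does not depend on \<open>xs\<close>, this is a fixed finite
    family.\<close>
  define \<Phi> where "\<Phi> = (\<Union>F \<in> Fs. (\<lambda>l xs. up_ring.coeff P (P.indexed_poly_eval F (R.unpack (\<alpha> + 1) b m xs)) l) ` {..e F})"
  have iff: "(\<forall>F \<in> Fs. P.indexed_poly_eval F (R.unpack (\<alpha> + 1) b m xs) = \<zero>\<^bsub>P\<^esub>) \<longleftrightarrow>
      (\<forall>f \<in> \<Phi>. f xs = \<zero>)" if xs: "xs \<in> R.tuples (\<alpha> + 1 + m * b)" for xs
  proof -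
    have "P.indexed_poly_eval F (R.unpack (\<alpha> + 1) b m xs) = \<zero>\<^bsub>P\<^esub> \<longleftrightarrow>
        (\<forall>l \<le> e F. up_ring.coeff P (P.indexed_poly_eval F (R.unpack (\<alpha> + 1) b m xs)) l = \<zero>)" if "F \<in> Fs" for F
      by (rule eq_zero_iff_coeff_atMost[OF P.indexed_poly_eval_closed[OF _ unpack_closed[OF xs]] e[OF that xs]])
        (use that assms(2) in blast)
    then show ?thesis
      by (auto simp: \<Phi>_def)
  qed
  have "R.diophantine (\<alpha> + 1)
      {as \<in> R.tuples (\<alpha> + 1). \<exists>bs \<in> R.tuples (m * b). \<forall>f \<in> \<Phi>. f (as @ bs) = \<zero>}"
  proof (rule R.diophantineI)
    show "finite \<Phi>"
      using assms(1) by (simp add: \<Phi>_def)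
    fix f assume "f \<in> \<Phi>"
    then show "R.polynomial_function (\<alpha> + 1 + m * b) f"
      using assms(2) unpack_closed coeff_unpack_polynomial_function
      by (auto simp: \<Phi>_def simp del: One_nat_def intro!: coeff_eval_polynomial_function)
  qed
  moreover have "{as \<in> R.tuples (\<alpha> + 1). \<exists>bs \<in> R.tuples (m * b). \<forall>f \<in> \<Phi>. f (as @ bs) = \<zero>}
      = {as \<in> R.tuples (\<alpha> + 1). \<exists>bs \<in> R.tuples (m * b). \<forall>F \<in> Fs.
          P.indexed_poly_eval F (R.unpack (\<alpha> + 1) b m (as @ bs)) = \<zero>\<^bsub>P\<^esub>}"
    using iff[OF R.tuples_append] by (intro Collect_cong conj_cong bex_cong) auto
  ultimately show ?thesis by simp
qed

lemma coeff_tuple_degree_part_diophantine: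
  assumes "P.diophantine 1 ((\<lambda>f. [f]) ` D)"
  shows "\<exists>\<Y>. countable \<Y> \<and> (\<forall>Y \<in> \<Y>. R.diophantine (\<alpha> + 1) Y) \<and>
    coeff_tuple R \<alpha> ` degree_part R D \<alpha> = \<Union>\<Y>"
proof -
  obtain m Fs where fin: "finite Fs" and Fs: "Fs \<subseteq> P.indexed_pset {..<1 + m} (carrier P)"
    and D: "(\<lambda>f. [f]) ` D = {as \<in> P.tuples 1. \<exists>bs \<in> P.tuples m.
      \<forall>F \<in> Fs. P.indexed_poly_eval F (as @ bs) = \<zero>\<^bsub>P\<^esub>}"
    using assms unfolding P.diophantine_def by blast
  have D_iff: "f \<in> D \<longleftrightarrow> f \<in> carrier P \<and>
      (\<exists>gs \<in> P.tuples m. \<forall>F \<in> Fs. P.indexed_poly_eval F (f # gs) = \<zero>\<^bsub>P\<^esub>)" for f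
  proof -
    have "f \<in> D \<longleftrightarrow> [f] \<in> (\<lambda>f. [f]) ` D" by auto
    then show ?thesis
      unfolding D by (simp add: P.tuples_def)
  qed
  \<comment> \<open>The piece \<open>Y \<beta>\<close> collects the parameters solvable with
    unknowns of degree at most \<beta>, hence with \<open>\<beta> + 1\<close> coefficients for each
    unknown.\<close>
  define Y where "Y \<beta> = {as \<in> R.tuples (\<alpha> + 1). \<exists>bs \<in> R.tuples (m * (\<beta> + 1)). \<forall>F \<in> Fs.
    P.indexed_poly_eval F (R.unpack (\<alpha> + 1) (\<beta> + 1) m (as @ bs)) = \<zero>\<^bsub>P\<^esub>}" for \<beta>
  have "coeff_tuple R \<alpha> ` degree_part R D \<alpha> = (\<Union>\<beta>. Y \<beta>)"
  proof (intro equalityI subsetI)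
    fix as assume "as \<in> coeff_tuple R \<alpha> ` degree_part R D \<alpha>"
    then obtain f gs where as: "as = coeff_tuple R \<alpha> f"
      and f: "f \<in> carrier P" "deg R f \<le> \<alpha>"
      and gs: "gs \<in> P.tuples m" "\<forall>F \<in> Fs. P.indexed_poly_eval F (f # gs) = \<zero>\<^bsub>P\<^esub>"
      by (auto simp: degree_part_def D_iff)
    \<comment> \<open>Inserting 0 keeps \<open>Max\<close> meaningful when there are no
      unknowns.\<close>
    define \<beta> where "\<beta> = Max (insert 0 (deg R ` set gs))"
    have "deg R g \<le> \<beta>" if "g \<in> set gs" for g
      using that by (simp add: \<beta>_def)
    with f gs(1) obtain bs where bs: "bs \<in> R.tuples (m * (\<beta> + 1))"
      "R.unpack (\<alpha> + 1) (\<beta> + 1) m (as @ bs) = f # gs"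
      unfolding as by (rule unpack_surj)
    have "as \<in> R.tuples (\<alpha> + 1)"
      using f by (auto simp: as R.tuples_def coeff_tuple_def P_def[symmetric])
    moreover have "\<forall>F \<in> Fs. P.indexed_poly_eval F (R.unpack (\<alpha> + 1) (\<beta> + 1) m (as @ bs)) = \<zero>\<^bsub>P\<^esub>"
      unfolding bs(2) by (rule gs(2))
    ultimately have "as \<in> Y \<beta>"
      using bs(1) unfolding Y_def by blast
    then show "as \<in> (\<Union>\<beta>. Y \<beta>)"
      by blast
  next
    fix as assume "as \<in> (\<Union>\<beta>. Y \<beta>)"
    then obtain \<beta> bs where as: "as \<in> R.tuples (\<alpha> + 1)" and bs: "bs \<in> R.tuples (m * (\<beta> + 1))"
      and zero: "\<forall>F \<in> Fs. P.indexed_poly_eval F (R.unpack (\<alpha> + 1) (\<beta> + 1) m (as @ bs)) = \<zero>\<^bsub>P\<^esub>"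
      unfolding Y_def by blast
    obtain f gs where fg: "R.unpack (\<alpha> + 1) (\<beta> + 1) m (as @ bs) = f # gs"
      by (simp add: R.unpack_def)
    \<comment> \<open>Unpacked entries are genuine polynomials, so \<open>gs\<close> witnesses that
      \<open>f\<close> lies in \<open>D\<close>, whatever the value of \<beta>.\<close>
    with unpack_closed[OF R.tuples_append[OF as bs]] have "f \<in> carrier P" and "gs \<in> P.tuples m"
      by (auto simp: P.tuples_def)
    with zero have "f \<in> D"
      unfolding D_iff fg by blast
    moreover have "coeff_tuple R \<alpha> f = as" and "deg R f \<le> \<alpha>"
      using coeff_tuple_hd_unpack[OF as bs, unfolded fg nth_Cons_0] .
    ultimately show "as \<in> coeff_tuple R \<alpha> ` degree_part R D \<alpha>"
      by (auto simp: degree_part_def)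
  qed
  moreover have "R.diophantine (\<alpha> + 1) (Y \<beta>)" for \<beta>
    unfolding Y_def by (rule diophantine_bounded_unknowns[OF fin Fs])
  ultimately show ?thesis
    by (intro exI[of _ "range Y"]) auto
qed

end

theorem theorem1p2:
  fixes A (structure) and D :: "(nat \<Rightarrow> 'a) set" and \<alpha> :: nat
  assumes "cring A"
    and "D \<subseteq> carrier (UP A)"
    and "ring.diophantine (UP A) 1 ((\<lambda>f. [f]) ` D)"
  shows "\<exists>\<Y>. countable \<Y> \<and> (\<forall>Y \<in> \<Y>. ring.diophantine A (\<alpha> + 1) Y) \<and>
    coeff_tuple A \<alpha> ` degree_part A D \<alpha> = \<Union>\<Y>"
  by (rule UP_cring.coeff_tuple_degree_part_diophantine[OF UP_cring.intro[OF assms(1)] assms(3)])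

end
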